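(* There is a Borel finitely productive maximal eventually different family $\mathcal{E}_{<\omega}$.
   Context: For countable sets $A,B$ and $f,g \in {}^{A}B$ (functions from $A$ to $B$) let $E(f,g) := \{a \in A \mid f(a) = g(a)\}$; $f$ and $g$ are eventually different if $E(f,g)$ is finite. A family $\mathcal{F} \subseteq {}^{A}B$ is eventually different (ed) if its members are pairwise eventually different, and it is maximal eventually different (med) if it is maximal with respect to inclusion among ed families contained in ${}^{A}B$. For functions $f_1,\dots,f_n$ with the same domain, $(f_1\times\dots\times f_n)(a) := (f_1(a),\dots,f_n(a))$. For a family $\mathcal{F} \subseteq {}^{A}B$ and $n \geq 1$, $\mathcal{F}^n := \{f_1 \times \dots \times f_n \mid f_1,\dots,f_n \in \mathcal{F}\} \subseteq {}^{A}(B^n)$. A med family $\mathcal{F}\subseteq {}^{A}B$ is $n$-productive if $\mathcal{F}^n$ is a med family in ${}^{A}(B^n)$, and finitely productive if it is $n$-productive for all $n \geq 1$. By default families consist of functions from $\omega$ to $\omega$ (equivalently, from $\omega$ to any fixed countably infinite set, via a bijection with $\omega$), and "Borel" refers to the product topology on ${}^{\omega}\omega$ with $\omega$ discrete. *)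

theory Defs
  imports "HOL-Analysis.Analysis"
begin

text \<open>
  The set of functions from \<open>A\<close> to \<open>B\<close> is the extensional function space \<open>A \<rightarrow>\<^sub>E B\<close>;
  for \<open>A = UNIV\<close> and \<open>B = UNIV\<close> this is the whole function type. The set \<open>B^n\<close> consists
  of the lists of length \<open>n\<close> over \<open>B\<close>. Borel subsets of \<open>nat \<Rightarrow> nat\<close> are the elements of
  \<open>sets borel\<close>: the topology on functions is the product topology and \<open>nat\<close> is discrete.
\<close>

definition agreement :: "'a set \<Rightarrow> ('a \<Rightarrow> 'b) \<Rightarrow> ('a \<Rightarrow> 'b) \<Rightarrow> 'a set" where
  "agreement A f g = {a \<in> A. f a = g a}"

definition eventually_different :: "'a set \<Rightarrow> ('a \<Rightarrow> 'b) \<Rightarrow> ('a \<Rightarrow> 'b) \<Rightarrow> bool" where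
  "eventually_different A f g \<longleftrightarrow> finite (agreement A f g)"

definition ed_family :: "'a set \<Rightarrow> 'b set \<Rightarrow> ('a \<Rightarrow> 'b) set \<Rightarrow> bool" where
  "ed_family A B F \<longleftrightarrow> F \<subseteq> A \<rightarrow>\<^sub>E B \<and> pairwise (eventually_different A) F"

definition med_family :: "'a set \<Rightarrow> 'b set \<Rightarrow> ('a \<Rightarrow> 'b) set \<Rightarrow> bool" where
  "med_family A B F \<longleftrightarrow> ed_family A B F \<and> (\<forall>G. ed_family A B G \<and> F \<subseteq> G \<longrightarrow> G = F)"

definition set_power :: "'b set \<Rightarrow> nat \<Rightarrow> 'b list set" where
  "set_power B n = {xs. set xs \<subseteq> B \<and> length xs = n}"

definition fun_product :: "'a set \<Rightarrow> ('a \<Rightarrow> 'b) list \<Rightarrow> 'a \<Rightarrow> 'b list" where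
  "fun_product A fs = (\<lambda>a\<in>A. map (\<lambda>f. f a) fs)"

definition family_power :: "'a set \<Rightarrow> ('a \<Rightarrow> 'b) set \<Rightarrow> nat \<Rightarrow> ('a \<Rightarrow> 'b list) set" where
  "family_power A F n = {fun_product A fs | fs. set fs \<subseteq> F \<and> length fs = n}"

definition n_productive :: "'a set \<Rightarrow> 'b set \<Rightarrow> nat \<Rightarrow> ('a \<Rightarrow> 'b) set \<Rightarrow> bool" where
  "n_productive A B n F \<longleftrightarrow>
     med_family A B F \<and> med_family A (set_power B n) (family_power A F n)"

definition finitely_productive :: "'a set \<Rightarrow> 'b set \<Rightarrow> ('a \<Rightarrow> 'b) set \<Rightarrow> bool" where
  "finitely_productive A B F \<longleftrightarrow> (\<forall>n\<ge>1. n_productive A B n F)"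

end

theory Submission
  imports Defs "HOL-Library.Nat_Bijection"
begin

text \<open>
  The functions \<open>m \<mapsto> code (y 0, \<dots>, y m)\<close>, one for each real \<open>y\<close>, form an eventually different
  family, because distinct reals have only finitely many initial segments in common. This family is
  not maximal. It is made maximal, and indeed finitely productive, by altering some of its members
  on small sets so that they catch prescribed tuples of functions.

  Read \<open>y\<close> as a natural number \<open>t = y 0\<close> followed by a real \<open>h\<close>, the tail of \<open>y\<close>, and read \<open>h\<close> as
  a finite tuple of functions \<open>p\<^sub>0, \<dots>, p\<^sub>n\<^sub>-\<^sub>1\<close>. An infinite set, the arena of \<open>h\<close>, is attached to \<open>h\<close>.
  Arenas of distinct reals are almost disjoint: the arena of \<open>h\<close> consists of even numbers that code
  initial segments of \<open>h\<close>. On the arena every \<open>p\<^sub>i\<close> behaves in one of three ways: it equals some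
  earlier \<open>p\<^sub>i\<^sub>'\<close>; or it equals the prefix code of one real; or it is wild, that is, eventually
  different from all prefix codes and from all earlier \<open>p\<^sub>i\<^sub>'\<close>. The member with index \<open>y\<close> is the prefix
  code of \<open>y\<close>, except that for \<open>t\<close> in a certain block of length \<open>n\<close> the values on the arena are
  replaced by those of the corresponding \<open>p\<^sub>i\<close>, provided that \<open>p\<^sub>i\<close> is wild.

  Members remain eventually different (\<open>finite_member_agreement\<close>): a wild function meets each
  prefix code and each other wild coordinate finitely often, and values copied for different \<open>h\<close> sit
  on almost disjoint sets. Every tuple is caught on an infinite set (\<open>members_catch_tuple\<close>): on the
  arena of its code, a wild coordinate is copied into a member, and a coordinate that follows the
  prefix code of \<open>z\<close> is caught by the member with index \<open>z\<close>, which is almost everywhere unaltered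
  there. For the latter the block of altered indices has to begin above \<open>z 0\<close> in case that \<open>z\<close> has
  tail \<open>h\<close>.

  Catching all tuples of length \<open>n\<close> amounts to maximality of the \<open>n\<close>-th power. The family is Borel
  because the arena is found by a canonical, countably described thinning rather than by an appeal to
  Ramsey's theorem, and because the index \<open>y\<close> can be read off from the values of its member at odd
  places, which are never altered. So the family is the set of fixed points of a Borel map, and no
  theorem on injective Borel images is involved.
\<close>

section \<open>Codes of initial segments\<close>

definition prefix_code :: "(nat \<Rightarrow> nat) \<Rightarrow> nat \<Rightarrow> nat" where
  "prefix_code y m = list_encode (map y [0..<Suc m])"

lemma prefix_code_eq_iff: "prefix_code y m = prefix_code z m \<longleftrightarrow> (\<forall>k\<le>m. y k = z k)"
  by (auto simp: prefix_code_def list_encode_eq less_Suc_eq_le simp del: upt_Suc)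

lemma nth_list_decode_prefix_code: "k \<le> m \<Longrightarrow> list_decode (prefix_code y m) ! k = y k"
  by (simp add: prefix_code_def del: upt_Suc)

lemma hd_list_decode_prefix_code: "hd (list_decode (prefix_code y m)) = y 0"
  by (simp add: prefix_code_def hd_map del: upt_Suc)

lemma finite_prefix_code_agreement:
  assumes "y \<noteq> z"
  shows "finite {m. prefix_code y m = prefix_code z m}"
proof -
  obtain k where "y k \<noteq> z k" using assms by blast
  then have "{m. prefix_code y m = prefix_code z m} \<subseteq> {..<k}"
    by (auto simp: prefix_code_eq_iff not_le[symmetric])
  then show ?thesis by (rule finite_subset) simp
qed

text \<open>
  The values of \<open>p\<close> at the two places are nodes of the tree of initial segments, and the second node
  extends the first.
\<close>

definition linked :: "(nat \<Rightarrow> nat) \<Rightarrow> nat \<Rightarrow> nat \<Rightarrow> bool" where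
  "linked p m m' \<longleftrightarrow> m < m' \<and> (\<exists>y. p m = prefix_code y m \<and> p m' = prefix_code y m')"

lemma linked_trans:
  assumes "linked p a b" "linked p b c"
  shows "linked p a c"
proof -
  obtain y where y: "p a = prefix_code y a" "p b = prefix_code y b"
    using assms(1) by (auto simp: linked_def)
  obtain z where z: "p b = prefix_code z b" "p c = prefix_code z c"
    using assms(2) by (auto simp: linked_def)
  have "a < b" "b < c" using assms by (auto simp: linked_def)
  moreover have "prefix_code y a = prefix_code z a"
    using trans[OF y(2)[symmetric] z(1)] \<open>a < b\<close> by (simp add: prefix_code_eq_iff)
  ultimately show ?thesis using y z by (auto simp: linked_def)
qed

text \<open>
  A chain of nodes is the same as a single branch, the union of the chain. The left-hand side only
  quantifies over natural numbers, which makes it the form that is visibly Borel.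
\<close>

lemma pairwise_linked_iff:
  assumes "infinite H"
  shows "(\<forall>m\<in>H. \<forall>m'\<in>H. m < m' \<longrightarrow> linked p m m') \<longleftrightarrow> (\<exists>y. \<forall>m\<in>H. p m = prefix_code y m)"
proof
  assume link: "\<forall>m\<in>H. \<forall>m'\<in>H. m < m' \<longrightarrow> linked p m m'"
  have "\<exists>y. p m = prefix_code y m" if "m \<in> H" for m
  proof -
    obtain m' where "m' \<in> H" "m < m'" using assms infinite_nat_iff_unbounded by blast
    then show ?thesis using link that by (auto simp: linked_def)
  qed
  then obtain Y where Y: "\<And>m. m \<in> H \<Longrightarrow> p m = prefix_code (Y m) m" by metis
  have agree: "Y m k = Y m' k" if "m \<in> H" "m' \<in> H" "m \<le> m'" "k \<le> m" for m m' k
  proof (cases "m = m'")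
    case False
    then have "linked p m m'" using link that by simp
    then obtain y where "p m = prefix_code y m" "p m' = prefix_code y m'"
      by (auto simp: linked_def)
    with Y that(1,2) have "prefix_code (Y m) m = prefix_code y m"
      "prefix_code (Y m') m' = prefix_code y m'" by auto
    then show ?thesis using that(3,4) by (simp add: prefix_code_eq_iff)
  qed simp
  define nxt where "nxt k = (LEAST m. m \<in> H \<and> k \<le> m)" for k
  have nxt: "nxt k \<in> H \<and> k \<le> nxt k" for k
    unfolding nxt_def by (rule LeastI_ex) (use assms infinite_nat_iff_unbounded_le in blast)
  have nxt_le: "nxt k \<le> m" if "m \<in> H" "k \<le> m" for k m
    unfolding nxt_def using that by (simp add: Least_le)
  have "p m = prefix_code (\<lambda>k. Y (nxt k) k) m" if "m \<in> H" for m
  proof -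
    have "Y m k = Y (nxt k) k" if "k \<le> m" for k
      using agree[of "nxt k" m k] nxt[of k] nxt_le[OF \<open>m \<in> H\<close> that] \<open>m \<in> H\<close> by simp
    then show ?thesis using Y[OF that] by (simp add: prefix_code_eq_iff)
  qed
  then show "\<exists>y. \<forall>m\<in>H. p m = prefix_code y m" by blast
next
  assume "\<exists>y. \<forall>m\<in>H. p m = prefix_code y m"
  then show "\<forall>m\<in>H. \<forall>m'\<in>H. m < m' \<longrightarrow> linked p m m'"
    by (auto simp: linked_def)
qed

section \<open>Canonical homogeneous sets\<close>

text \<open>
  The thinning for one function \<open>p\<close> separates the places whose node has only finitely many
  extensions among the nodes at places in \<open>Y\<close>. These are kept when there are infinitely many of them. Otherwise
  almost every node has infinitely many extensions, and the thread climbs along them, always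
  taking the least possible place. Which case occurs is an arithmetical question; asking instead
  whether some infinite chain exists would be analytic.
\<close>

definition thin :: "(nat \<Rightarrow> nat) \<Rightarrow> nat set \<Rightarrow> nat set" where
  "thin p Y = {m \<in> Y. finite {m' \<in> Y. linked p m m'}}"

definition thread :: "(nat \<Rightarrow> nat) \<Rightarrow> nat set \<Rightarrow> nat set" where
  "thread p G =
     range (\<lambda>k. ((\<lambda>m. LEAST m'. m' \<in> G \<and> linked p m m') ^^ k) (LEAST m. m \<in> G))"

definition settle :: "(nat \<Rightarrow> nat) \<Rightarrow> nat set \<Rightarrow> nat set" where
  "settle p Y = (if infinite (thin p Y) then thin p Y else thread p (Y - thin p Y))"

text \<open>
  If a branch passed through infinitely many thin nodes, then the first of these nodes would have
  all later ones as extensions.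
\<close>

lemma finite_thin_agreement: "finite {m \<in> thin p Y. p m = prefix_code y m}"
proof (rule ccontr)
  let ?A = "{m \<in> thin p Y. p m = prefix_code y m}"
  assume inf: "infinite ?A"
  then obtain a where a: "a \<in> ?A" by (metis finite.emptyI ex_in_conv)
  have "?A - {..a} \<subseteq> {m' \<in> Y. linked p a m'}"
    using a by (auto simp: thin_def linked_def)
  moreover have "finite {m' \<in> Y. linked p a m'}" using a by (simp add: thin_def)
  ultimately have "finite (?A - {..a})" by (rule finite_subset)
  then show False using inf by simp
qed

lemma thread_homogeneous:
  assumes "G \<noteq> {}" and succ: "\<And>m. m \<in> G \<Longrightarrow> \<exists>m'\<in>G. linked p m m'"
  shows "thread p G \<subseteq> G \<and> infinite (thread p G) \<and> (\<exists>y. \<forall>m\<in>thread p G. p m = prefix_code y m)"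
proof -
  define nxt where "nxt m = (LEAST m'. m' \<in> G \<and> linked p m m')" for m
  define c where "c k = (nxt ^^ k) (LEAST m. m \<in> G)" for k
  have thread: "thread p G = range c"
    unfolding thread_def c_def nxt_def by simp
  have nxt: "nxt m \<in> G \<and> linked p m (nxt m)" if "m \<in> G" for m
    unfolding nxt_def by (rule LeastI_ex) (use succ[OF that] in blast)
  have c_in: "c k \<in> G" for k
  proof (induction k)
    case 0
    show ?case using assms(1) LeastI_ex[of "\<lambda>m. m \<in> G"] by (auto simp: c_def)
  next
    case (Suc k)
    then show ?case using nxt[of "c k"] by (simp add: c_def)
  qed
  have step: "linked p (c i) (c (Suc i))" for i
    using nxt[OF c_in, of i] by (simp add: c_def)
  have linked: "linked p (c i) (c j)" if "i < j" for i j
    using that by (induction rule: less_Suc_induct) (fact step, rule linked_trans)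
  then have mono: "strict_mono c" by (auto simp: strict_mono_def linked_def)
  have inf: "infinite (range c)"
    using mono by (simp add: strict_mono_imp_inj_on range_inj_infinite)
  have "\<forall>m\<in>range c. \<forall>m'\<in>range c. m < m' \<longrightarrow> linked p m m'"
    using linked mono by (auto simp: strict_mono_less)
  then show ?thesis
    using c_in inf pairwise_linked_iff[OF inf] by (auto simp: thread)
qed

lemma settle_homogeneous:
  assumes "infinite Y"
  shows "settle p Y \<subseteq> Y \<and> infinite (settle p Y) \<and>
    ((\<forall>y. finite {m \<in> settle p Y. p m = prefix_code y m}) \<or>
     (\<exists>y. \<forall>m\<in>settle p Y. p m = prefix_code y m))"
proof (cases "infinite (thin p Y)")
  case True
  then show ?thesis
    using finite_thin_agreement[of p Y] by (simp add: settle_def) (simp add: thin_def)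
next
  case False
  let ?G = "Y - thin p Y"
  have "?G \<noteq> {}" using assms False by (metis Diff_infinite_finite finite.emptyI)
  moreover have "\<exists>m'\<in>?G. linked p m m'" if "m \<in> ?G" for m
  proof -
    have "infinite {m' \<in> Y. linked p m m'}" using that by (simp add: thin_def)
    then have "infinite ({m' \<in> Y. linked p m m'} - thin p Y)"
      using False by (simp add: Diff_infinite_finite)
    then have "{m' \<in> Y. linked p m m'} - thin p Y \<noteq> {}" by (metis finite.emptyI)
    then show ?thesis by blast
  qed
  ultimately show ?thesis
    using thread_homogeneous[of ?G p] False by (auto simp: settle_def)
qed

text \<open>
  The least suitable \<open>i'\<close> is chosen only in order to have a canonical, hence Borel, selection.
\<close>

definition equalize :: "(nat \<Rightarrow> nat \<Rightarrow> nat) \<Rightarrow> nat \<Rightarrow> nat set \<Rightarrow> nat set" where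
  "equalize p i Y =
     (if \<exists>i'<i. infinite {m \<in> Y. p i m = p i' m}
      then {m \<in> Y. p i m = p (LEAST i'. infinite {m \<in> Y. p i m = p i' m}) m} else Y)"

lemma equalize_homogeneous:
  assumes "infinite Y"
  shows "equalize p i Y \<subseteq> Y \<and> infinite (equalize p i Y) \<and>
    ((\<exists>i'<i. \<forall>m\<in>equalize p i Y. p i m = p i' m) \<or>
     (\<forall>i'<i. finite {m \<in> equalize p i Y. p i m = p i' m}))"
proof (cases "\<exists>i'<i. infinite {m \<in> Y. p i m = p i' m}")
  case True
  define l where "l = (LEAST i'. infinite {m \<in> Y. p i m = p i' m})"
  obtain i' where i': "i' < i" "infinite {m \<in> Y. p i m = p i' m}" using True by blast
  have "infinite {m \<in> Y. p i m = p l m}"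
    unfolding l_def by (rule LeastI[of _ i']) (rule i'(2))
  moreover have "l \<le> i'" unfolding l_def by (rule Least_le) (rule i'(2))
  moreover have "equalize p i Y = {m \<in> Y. p i m = p l m}"
    using True unfolding equalize_def l_def by (rule if_P)
  moreover have "l < i" using calculation(2) i'(1) by simp
  ultimately have "(\<exists>i'<i. \<forall>m\<in>equalize p i Y. p i m = p i' m) \<and>
      equalize p i Y \<subseteq> Y \<and> infinite (equalize p i Y)" by auto
  then show ?thesis by blast
next
  case False
  then have "equalize p i Y = Y" unfolding equalize_def by (rule if_not_P)
  then show ?thesis using False assms by auto
qed

text \<open>
  All properties obtained at one stage (equality with an earlier coordinate, agreement with a branch,
  finiteness of an agreement set) pass to subsets, so the coordinates can be treated in turn.
\<close>

primrec homog :: "(nat \<Rightarrow> nat \<Rightarrow> nat) \<Rightarrow> nat set \<Rightarrow> nat \<Rightarrow> nat set" where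
  "homog p Y 0 = Y"
| "homog p Y (Suc i) = settle (p i) (equalize p i (homog p Y i))"

definition duplicate :: "(nat \<Rightarrow> nat \<Rightarrow> nat) \<Rightarrow> nat set \<Rightarrow> nat \<Rightarrow> bool" where
  "duplicate p H i \<longleftrightarrow> (\<exists>i'<i. \<forall>m\<in>H. p i m = p i' m)"

text \<open>
  Wildness only denies the other two alternatives. On the canonical homogeneous sets this
  already gives the finiteness statements of \<open>wild_homog\<close>, whose direct formulation would quantify
  over all reals.
\<close>

definition wild :: "(nat \<Rightarrow> nat \<Rightarrow> nat) \<Rightarrow> nat set \<Rightarrow> nat \<Rightarrow> bool" where
  "wild p H i \<longleftrightarrow>
     \<not> duplicate p H i \<and> \<not> (\<forall>m\<in>H. \<forall>m'\<in>H. m < m' \<longrightarrow> linked (p i) m m')"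

lemma homog_infinite_subset:
  assumes "infinite Y"
  shows "infinite (homog p Y n)" and "homog p Y n \<subseteq> Y"
proof -
  have "infinite (homog p Y n) \<and> homog p Y n \<subseteq> Y"
  proof (induction n)
    case (Suc n)
    then have E: "equalize p n (homog p Y n) \<subseteq> homog p Y n" "infinite (equalize p n (homog p Y n))"
      using equalize_homogeneous[of "homog p Y n" p n] by blast+
    then have "infinite (homog p Y (Suc n))" "homog p Y (Suc n) \<subseteq> equalize p n (homog p Y n)"
      using settle_homogeneous[of "equalize p n (homog p Y n)" "p n"] unfolding homog.simps by blast+
    with E Suc show ?case by blast
  qed (use assms in simp)
  then show "infinite (homog p Y n)" "homog p Y n \<subseteq> Y" by auto
qed

lemma homog_antimono:
  assumes "infinite Y" "i \<le> n"
  shows "homog p Y n \<subseteq> homog p Y i"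
  using assms(2)
proof (induction n rule: dec_induct)
  case (step n)
  have inf: "infinite (homog p Y n)" using assms(1) by (rule homog_infinite_subset)
  have E: "equalize p n (homog p Y n) \<subseteq> homog p Y n" "infinite (equalize p n (homog p Y n))"
    using equalize_homogeneous[OF inf, of p n] by blast+
  have "homog p Y (Suc n) \<subseteq> equalize p n (homog p Y n)"
    using settle_homogeneous[OF E(2), of "p n"] unfolding homog.simps by blast
  then show ?case using E step.IH by blast
qed simp

lemma wild_homog:
  assumes Y: "infinite Y" and "i < n" and wild: "wild p (homog p Y n) i"
  shows "finite {m \<in> homog p Y n. p i m = prefix_code y m}"
    and "i' < i \<Longrightarrow> finite {m \<in> homog p Y n. p i m = p i' m}"
proof -
  let ?M = "equalize p i (homog p Y i)" and ?H = "homog p Y n"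
  have inf: "infinite ?H" using Y by (rule homog_infinite_subset)
  have M: "?M \<subseteq> homog p Y i" "infinite ?M"
    and or1: "(\<exists>i'<i. \<forall>m\<in>?M. p i m = p i' m) \<or> (\<forall>i'<i. finite {m \<in> ?M. p i m = p i' m})"
    using equalize_homogeneous[OF homog_infinite_subset(1)[OF Y], of p i] by blast+
  have S: "settle (p i) ?M \<subseteq> ?M"
    and or2: "(\<forall>y. finite {m \<in> settle (p i) ?M. p i m = prefix_code y m}) \<or>
      (\<exists>y. \<forall>m\<in>settle (p i) ?M. p i m = prefix_code y m)"
    using settle_homogeneous[OF M(2), of "p i"] by blast+
  have HS: "?H \<subseteq> settle (p i) ?M"
    using homog_antimono[OF Y, of "Suc i" n p] \<open>i < n\<close> by simp
  \<comment> \<open>Each dichotomy was decided at stage \<open>i\<close>; its homogeneous alternative would have survived in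
    the final set and is excluded there by wildness.\<close>
  have "\<not> (\<exists>y. \<forall>m\<in>settle (p i) ?M. p i m = prefix_code y m)"
    using wild HS unfolding wild_def pairwise_linked_iff[OF inf] by blast
  then have "finite {m \<in> settle (p i) ?M. p i m = prefix_code y m}" using or2 by blast
  then show "finite {m \<in> ?H. p i m = prefix_code y m}"
    by (rule rev_finite_subset) (use HS in auto)
  have "\<not> (\<exists>i'<i. \<forall>m\<in>?M. p i m = p i' m)"
    using wild subset_trans[OF HS S] unfolding wild_def duplicate_def by blast
  then have *: "\<forall>i'<i. finite {m \<in> ?M. p i m = p i' m}" using or1 by blast
  show "finite {m \<in> ?H. p i m = p i' m}" if "i' < i"
    by (rule rev_finite_subset[OF *[rule_format, OF that]]) (use HS S in auto)
qed

section \<open>The family\<close>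

definition coord :: "(nat \<Rightarrow> nat) \<Rightarrow> nat \<Rightarrow> nat \<Rightarrow> nat" where
  "coord h i m = list_decode (h m) ! i"

text \<open>
  Almost disjoint sets in the classical way, from codes of initial segments. The factor 2 keeps the odd
  places free, so that they can store the index of a member.
\<close>

definition trail :: "(nat \<Rightarrow> nat) \<Rightarrow> nat set" where
  "trail h = range (\<lambda>k. 2 * list_encode (map h [0..<k]))"

lemma infinite_trail: "infinite (trail h)"
proof -
  have "inj (\<lambda>k. 2 * list_encode (map h [0..<k]))"
    by (rule injI) (auto simp: list_encode_eq dest: arg_cong[where f = length])
  then show ?thesis by (simp add: trail_def range_inj_infinite)
qed

lemma even_trail: "m \<in> trail h \<Longrightarrow> even m"
  by (auto simp: trail_def)

lemma finite_trail_Int: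
  assumes "h \<noteq> h'"
  shows "finite (trail h \<inter> trail h')"
proof -
  obtain k where k: "h k \<noteq> h' k" using assms by blast
  have "trail h \<inter> trail h' \<subseteq> (\<lambda>l. 2 * list_encode (map h [0..<l])) ` {..k}"
  proof
    fix m assume "m \<in> trail h \<inter> trail h'"
    then obtain a b where a: "m = 2 * list_encode (map h [0..<a])"
      and b: "m = 2 * list_encode (map h' [0..<b])" unfolding trail_def by blast
    then have eq: "map h [0..<a] = map h' [0..<b]" by (simp add: list_encode_eq)
    then have "a = b" by (auto dest: arg_cong[where f = length])
    then have "\<not> k < a" using eq k by auto
    then show "m \<in> (\<lambda>l. 2 * list_encode (map h [0..<l])) ` {..k}" using a by auto
  qed
  then show ?thesis by (rule finite_subset) simp
qed

definition arity :: "(nat \<Rightarrow> nat) \<Rightarrow> nat" where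
  "arity h = length (list_decode (h 0))"

definition arena :: "(nat \<Rightarrow> nat) \<Rightarrow> nat set" where
  "arena h = homog (coord h) (trail h) (arity h)"

lemma infinite_arena: "infinite (arena h)"
  unfolding arena_def using infinite_trail by (rule homog_infinite_subset)

lemma arena_subset_trail: "arena h \<subseteq> trail h"
  unfolding arena_def using infinite_trail by (rule homog_infinite_subset)

text \<open>
  If some coordinate follows a prefix code of \<open>z\<close> on the arena, then its value at the least place of
  the arena codes a list that begins with \<open>z 0\<close>. The successor of the sum over all coordinates exceeds each such
  number, and it depends on \<open>h\<close> in a Borel way.
\<close>

definition offset :: "(nat \<Rightarrow> nat) \<Rightarrow> nat" where
  "offset h = Suc (sum_list (map (hd \<circ> list_decode) (list_decode (h (LEAST m. m \<in> arena h)))))"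

definition tail :: "(nat \<Rightarrow> nat) \<Rightarrow> nat \<Rightarrow> nat" where
  "tail y k = y (Suc k)"

definition slot :: "(nat \<Rightarrow> nat) \<Rightarrow> nat" where
  "slot y = y 0 - offset (tail y)"

definition swapped :: "(nat \<Rightarrow> nat) \<Rightarrow> nat \<Rightarrow> bool" where
  "swapped y m \<longleftrightarrow> offset (tail y) \<le> y 0 \<and> slot y < arity (tail y) \<and>
     wild (coord (tail y)) (arena (tail y)) (slot y) \<and> m \<in> arena (tail y)"

definition member :: "(nat \<Rightarrow> nat) \<Rightarrow> nat \<Rightarrow> nat" where
  "member y m = (if swapped y m then coord (tail y) (slot y) m else prefix_code y m)"

lemma finite_swapped_prefix_agreement:
  "finite {m. swapped y m \<and> coord (tail y) (slot y) m = prefix_code z m}"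
proof (cases "\<exists>m. swapped y m")
  case True
  then have "finite {m \<in> arena (tail y). coord (tail y) (slot y) m = prefix_code z m}"
    unfolding arena_def swapped_def by (intro wild_homog(1) infinite_trail) auto
  then show ?thesis by (rule rev_finite_subset) (auto simp: swapped_def)
qed simp

text \<open>
  Members with different tails are altered on almost disjoint sets. Members with the same tail are
  altered to different wild coordinates, and the one with the larger index is eventually different
  from the other.
\<close>

lemma finite_swapped_swapped_agreement:
  assumes "y \<noteq> z"
  shows "finite {m. swapped y m \<and> swapped z m \<and>
    coord (tail y) (slot y) m = coord (tail z) (slot z) m}" (is "finite ?A")
proof (cases "tail y = tail z")
  case False
  have "?A \<subseteq> trail (tail y) \<inter> trail (tail z)"
    using arena_subset_trail by (auto simp: swapped_def)
  then show ?thesis using finite_trail_Int[OF False] by (rule finite_subset)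
next
  case eq: True
  show ?thesis
  proof (cases "?A = {}")
    case False
    let ?h = "tail z"
    from False obtain m where m: "swapped y m" "swapped z m" by blast
    have "y 0 \<noteq> z 0"
    proof
      assume "y 0 = z 0"
      then have "y k = z k" for k using fun_cong[OF eq] by (cases k) (auto simp: tail_def)
      then show False using assms by blast
    qed
    then have "slot y \<noteq> slot z" using m eq by (auto simp: swapped_def slot_def)
    then consider "slot y < slot z" | "slot z < slot y" by linarith
    then have "finite {m \<in> arena ?h. coord ?h (slot y) m = coord ?h (slot z) m}"
    proof cases
      case 1
      then have "finite {m \<in> arena ?h. coord ?h (slot z) m = coord ?h (slot y) m}"
        using m eq unfolding arena_def swapped_def by (intro wild_homog(2) infinite_trail) auto
      then show ?thesis by (simp add: eq_commute)
    next
      case 2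
      then show ?thesis
        using m eq unfolding arena_def swapped_def by (intro wild_homog(2) infinite_trail) auto
    qed
    then show ?thesis by (rule rev_finite_subset) (use eq in \<open>auto simp: swapped_def\<close>)
  qed (simp only: finite.emptyI)
qed

lemma finite_member_agreement:
  assumes "y \<noteq> z"
  shows "finite {m. member y m = member z m}"
proof -
  have "{m. member y m = member z m} \<subseteq>
    {m. prefix_code y m = prefix_code z m} \<union>
    {m. swapped y m \<and> coord (tail y) (slot y) m = prefix_code z m} \<union>
    {m. swapped z m \<and> coord (tail z) (slot z) m = prefix_code y m} \<union>
    {m. swapped y m \<and> swapped z m \<and> coord (tail y) (slot y) m = coord (tail z) (slot z) m}"
    by (auto simp: member_def split: if_splits)
  then show ?thesis
    using finite_prefix_code_agreement[OF assms] finite_swapped_swapped_agreement[OF assms]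
      finite_swapped_prefix_agreement[of y z] finite_swapped_prefix_agreement[of z y]
    by (meson finite_Un finite_subset)
qed

text \<open>
  Induction on \<open>i\<close> resolves repeated coordinates by the earlier one. A wild coordinate was copied
  into the member with the matching index. In the remaining case the member indexed by the branch
  \<open>y\<close> works unless it is altered at infinitely many places of the arena of \<open>h\<close>. Almost disjointness
  would then force \<open>h\<close> to be the tail of \<open>y\<close>, and the offset keeps such a \<open>y\<close> out of the altered
  block.
\<close>

lemma member_catches_coord:
  assumes "\<And>m. length (list_decode (h m)) = n" and "i < n"
  shows "\<exists>y. finite {m \<in> arena h. member y m \<noteq> coord h i m}"
  using \<open>i < n\<close>
proof (induction i rule: less_induct)
  case (less i)
  let ?H = "arena h"
  consider (dup) "duplicate (coord h) ?H i" | (wild) "wild (coord h) ?H i"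
    | (branch) "\<forall>m\<in>?H. \<forall>m'\<in>?H. m < m' \<longrightarrow> linked (coord h i) m m'"
    by (auto simp: wild_def)
  then show ?case
  proof cases
    case dup
    then obtain i' where i': "i' < i" "\<And>m. m \<in> ?H \<Longrightarrow> coord h i m = coord h i' m"
      by (auto simp: duplicate_def)
    obtain y where "finite {m \<in> ?H. member y m \<noteq> coord h i' m}"
      using less.IH[OF i'(1)] i'(1) less.prems by auto
    moreover have "{m \<in> ?H. member y m \<noteq> coord h i m} = {m \<in> ?H. member y m \<noteq> coord h i' m}"
      using i'(2) by auto
    ultimately show ?thesis by metis
  next
    case wild
    define y where "y = case_nat (offset h + i) h"
    have "tail y = h" by (simp add: y_def tail_def fun_eq_iff)
    moreover from this have "slot y = i" by (simp add: slot_def y_def)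
    moreover have "offset h \<le> y 0" by (simp add: y_def)
    moreover have "arity h = n" using assms(1) by (simp add: arity_def)
    ultimately have "member y m = coord h i m" if "m \<in> ?H" for m
      using that wild less.prems by (simp add: member_def swapped_def)
    then have "{m \<in> ?H. member y m \<noteq> coord h i m} = {}" by auto
    then show ?thesis by (metis finite.emptyI)
  next
    case branch
    then obtain y where y: "\<And>m. m \<in> ?H \<Longrightarrow> coord h i m = prefix_code y m"
      using iffD1[OF pairwise_linked_iff[OF infinite_arena]] by metis
    have "finite {m \<in> ?H. swapped y m}"
    proof (cases "tail y = h")
      case False
      have "{m \<in> ?H. swapped y m} \<subseteq> trail (tail y) \<inter> trail h"
        using arena_subset_trail by (auto simp: swapped_def)
      then show ?thesis using finite_trail_Int[OF False] by (rule finite_subset)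
    next
      case True
      define m where "m = (LEAST m. m \<in> ?H)"
      have "m \<in> ?H"
        using infinite_imp_nonempty[OF infinite_arena] unfolding m_def
        by (metis LeastI ex_in_conv)
      have "y 0 = hd (list_decode (coord h i m))"
        using y[OF \<open>m \<in> ?H\<close>] by (simp add: hd_list_decode_prefix_code)
      also have "\<dots> = (hd \<circ> list_decode) (list_decode (h m) ! i)" by (simp add: coord_def)
      also have "\<dots> \<in> set (map (hd \<circ> list_decode) (list_decode (h m)))"
        unfolding set_map using assms(1)[of m] less.prems by (intro imageI nth_mem) simp
      finally have "y 0 < offset h"
        unfolding offset_def m_def less_Suc_eq_le by (rule member_le_sum_list) simp_all
      then have "\<not> swapped y m" for m using True by (simp add: swapped_def)
      then show ?thesis by simp
    qed
    moreover have "{m \<in> ?H. member y m \<noteq> coord h i m} \<subseteq> {m \<in> ?H. swapped y m}"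
      using y by (auto simp: member_def)
    ultimately show ?thesis by (blast intro: finite_subset)
  qed
qed

text \<open>
  Each coordinate is caught on a cofinite part of the same arena, so finitely many of them are caught
  simultaneously on an infinite set.
\<close>

lemma members_catch_tuple:
  fixes g :: "nat \<Rightarrow> nat list"
  assumes "\<And>m. length (g m) = n"
  shows "\<exists>fs. length fs = n \<and> set fs \<subseteq> range member \<and> infinite {m. map (\<lambda>f. f m) fs = g m}"
proof -
  define h where "h m = list_encode (g m)" for m
  have coord: "coord h i m = g m ! i" for i m by (simp add: coord_def h_def)
  have "\<exists>y. finite {m \<in> arena h. member y m \<noteq> g m ! i}" if "i < n" for i
    using member_catches_coord[of h n i] that assms unfolding coord by (simp add: h_def)
  then obtain Y where Y: "\<And>i. i < n \<Longrightarrow> finite {m \<in> arena h. member (Y i) m \<noteq> g m ! i}"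
    by metis
  define fs where "fs = map (\<lambda>i. member (Y i)) [0..<n]"
  have "finite (\<Union>i<n. {m \<in> arena h. member (Y i) m \<noteq> g m ! i})" using Y by simp
  then have "infinite (arena h - (\<Union>i<n. {m \<in> arena h. member (Y i) m \<noteq> g m ! i}))"
    using infinite_arena by (simp add: Diff_infinite_finite)
  moreover have "arena h - (\<Union>i<n. {m \<in> arena h. member (Y i) m \<noteq> g m ! i}) \<subseteq>
      {m. map (\<lambda>f. f m) fs = g m}"
    using assms by (auto simp: fs_def intro!: nth_equalityI)
  ultimately have "infinite {m. map (\<lambda>f. f m) fs = g m}" by (rule infinite_super[rotated])
  moreover have "length fs = n" "set fs \<subseteq> range member" by (auto simp: fs_def)
  ultimately show ?thesis by blast
qed

section \<open>Borel measurability\<close>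

text \<open>
  The construction involves only operations on natural numbers, quantifiers over natural numbers
  and least witnesses, all of which preserve measurability. Everything is stated over an arbitrary
  measurable space \<open>M\<close> so that it can be applied with measurably varying functions and sets.
\<close>

lemma pred_infinite:
  assumes [measurable]: "\<And>m::nat. Measurable.pred M (\<lambda>x. m \<in> Y x)"
  shows "Measurable.pred M (\<lambda>x. infinite (Y x))"
  unfolding infinite_nat_iff_unbounded by measurable

lemma pred_countable_rel:
  fixes f :: "'a \<Rightarrow> 'b::countable" and g :: "'a \<Rightarrow> 'c"
  assumes f: "f \<in> measurable M (count_space UNIV)" and g: "g \<in> measurable M (count_space UNIV)"
  shows "Measurable.pred M (\<lambda>x. R (f x) (g x))"
  by (rule measurable_compose_countable[of "\<lambda>a x. R a (g x)", OF _ f])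
     (rule measurable_compose[OF g], simp)

lemma pred_linked:
  assumes [measurable]: "\<And>m. (\<lambda>x. p x m) \<in> measurable M (count_space UNIV)"
  shows "Measurable.pred M (\<lambda>x. linked (p x) m m')"
proof -
  \<comment> \<open>The quantifier over reals is harmless: it only defines a relation between two natural numbers.\<close>
  define Q where "Q u v \<longleftrightarrow> m < m' \<and> (\<exists>y. u = prefix_code y m \<and> v = prefix_code y m')" for u v
  have "Measurable.pred M (\<lambda>x. Q (p x m) (p x m'))" by measurable
  then show ?thesis by (simp add: linked_def Q_def)
qed

lemma pred_thin:
  assumes [measurable]: "\<And>m. (\<lambda>x. p x m) \<in> measurable M (count_space UNIV)"
    and [measurable]: "\<And>m. Measurable.pred M (\<lambda>x. m \<in> Y x)"
  shows "Measurable.pred M (\<lambda>x. m \<in> thin (p x) (Y x))"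
proof -
  note [measurable] = pred_linked[of p]
  have [measurable]: "Measurable.pred M (\<lambda>x. infinite {m' \<in> Y x. linked (p x) m m'})"
    by (rule pred_infinite) simp
  have "Measurable.pred M (\<lambda>x. m \<in> Y x \<and> \<not> infinite {m' \<in> Y x. linked (p x) m m'})"
    by measurable
  then show ?thesis by (simp add: thin_def)
qed

lemma pred_thread:
  assumes [measurable]: "\<And>m. (\<lambda>x. p x m) \<in> measurable M (count_space UNIV)"
    and [measurable]: "\<And>m. Measurable.pred M (\<lambda>x. m \<in> Y x)"
  shows "Measurable.pred M (\<lambda>x. m \<in> thread (p x) (Y x))"
proof -
  note [measurable] = pred_linked[of p]
  define nxt where "nxt x = (\<lambda>m. LEAST m'. m' \<in> Y x \<and> linked (p x) m m')" for x
  have nxt [measurable]: "(\<lambda>x. nxt x m) \<in> measurable M (count_space UNIV)" for m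
    unfolding nxt_def by measurable
  have [measurable]: "(\<lambda>x. (nxt x ^^ k) (LEAST m. m \<in> Y x)) \<in> measurable M (count_space UNIV)" for k
  proof (induction k)
    case (Suc k)
    show ?case
      using measurable_compose_countable[of "\<lambda>m x. nxt x m", OF nxt Suc] by simp
  qed simp
  have "Measurable.pred M (\<lambda>x. \<exists>k. m = (nxt x ^^ k) (LEAST m. m \<in> Y x))" by measurable
  then show ?thesis by (simp add: thread_def nxt_def image_iff)
qed

lemma pred_settle:
  assumes [measurable]: "\<And>m. (\<lambda>x. p x m) \<in> measurable M (count_space UNIV)"
    and [measurable]: "\<And>m. Measurable.pred M (\<lambda>x. m \<in> Y x)"
  shows "Measurable.pred M (\<lambda>x. m \<in> settle (p x) (Y x))"
proof -
  have thin [measurable]: "Measurable.pred M (\<lambda>x. m \<in> thin (p x) (Y x))" for m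
    by (rule pred_thin) measurable
  have [measurable]: "Measurable.pred M (\<lambda>x. infinite (thin (p x) (Y x)))"
    by (rule pred_infinite) measurable
  have [measurable]: "Measurable.pred M (\<lambda>x. m \<in> thread (p x) (Y x - thin (p x) (Y x)))" for m
    by (rule pred_thread) simp_all
  show ?thesis unfolding settle_def if_distrib[of "(\<in>) m"] by measurable
qed

lemma pred_equalize:
  assumes p [measurable]: "\<And>i m. (\<lambda>x. p x i m) \<in> measurable M (count_space UNIV)"
    and [measurable]: "\<And>m. Measurable.pred M (\<lambda>x. m \<in> Y x)"
  shows "Measurable.pred M (\<lambda>x. m \<in> equalize (p x) i (Y x))"
proof -
  have [measurable]: "Measurable.pred M (\<lambda>x. p x j m = p x j' m)" for j j' m
    using p p by (rule pred_countable_rel)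
  have [measurable]: "Measurable.pred M (\<lambda>x. infinite {m \<in> Y x. p x i m = p x i' m})" for i'
    by (rule pred_infinite, unfold mem_Collect_eq) measurable
  have least: "(\<lambda>x. LEAST i'. infinite {m \<in> Y x. p x i m = p x i' m})
      \<in> measurable M (count_space UNIV)"
    by measurable
  have [measurable]: "Measurable.pred M (\<lambda>x.
      p x i m = p x (LEAST i'. infinite {m \<in> Y x. p x i m = p x i' m}) m)"
    by (rule measurable_compose_countable[of "\<lambda>j x. p x i m = p x j m", OF _ least]) measurable
  have "Measurable.pred M (\<lambda>x. m \<in> Y x \<and>
      ((\<exists>i'\<in>{..<i}. infinite {m \<in> Y x. p x i m = p x i' m}) \<longrightarrow>
       p x i m = p x (LEAST i'. infinite {m \<in> Y x. p x i m = p x i' m}) m))"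
    by measurable
  then show ?thesis
    by (rule iffD1[OF arg_cong[where f = "Measurable.pred M"], rotated])
       (auto simp: equalize_def fun_eq_iff)
qed

lemma pred_homog:
  assumes p: "\<And>i m. (\<lambda>x. p x i m) \<in> measurable M (count_space UNIV)"
    and Y: "\<And>m. Measurable.pred M (\<lambda>x. m \<in> Y x)"
  shows "Measurable.pred M (\<lambda>x. m \<in> homog (p x) (Y x) n)"
proof (induction n arbitrary: m)
  case (Suc n)
  show ?case by (simp, intro pred_settle pred_equalize p Suc)
qed (use Y in simp)

lemma pred_wild:
  assumes p [measurable]: "\<And>i m. (\<lambda>x. p x i m) \<in> measurable M (count_space UNIV)"
    and [measurable]: "\<And>m. Measurable.pred M (\<lambda>x. m \<in> H x)"
  shows "Measurable.pred M (\<lambda>x. wild (p x) (H x) i)"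
proof -
  have [measurable]: "Measurable.pred M (\<lambda>x. p x i m = p x i' m)" for i' m
    using p p by (rule pred_countable_rel)
  have [measurable]: "Measurable.pred M (\<lambda>x. linked (p x i) m m')" for m m'
    by (rule pred_linked) measurable
  have [measurable]: "Measurable.pred M (\<lambda>x. duplicate (p x) (H x) i)"
  proof -
    have "Measurable.pred M (\<lambda>x. \<exists>i'\<in>{..<i}. \<forall>m. m \<in> H x \<longrightarrow> p x i m = p x i' m)" by measurable
    then show ?thesis by (simp add: duplicate_def Ball_def Bex_def)
  qed
  have "Measurable.pred M (\<lambda>x. \<not> duplicate (p x) (H x) i \<and>
      \<not> (\<forall>m m'. m \<in> H x \<and> m' \<in> H x \<and> m < m' \<longrightarrow> linked (p x i) m m'))"
    by measurable
  moreover have "(\<forall>m\<in>H x. \<forall>m'\<in>H x. m < m' \<longrightarrow> linked (p x i) m m') \<longleftrightarrow>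
      (\<forall>m m'. m \<in> H x \<and> m' \<in> H x \<and> m < m' \<longrightarrow> linked (p x i) m m')" for x
    by blast
  ultimately show ?thesis unfolding wild_def by simp
qed

lemma measurable_member:
  assumes y [measurable]: "\<And>k. (\<lambda>x. y x k) \<in> measurable M (count_space UNIV)"
  shows "(\<lambda>x. member (y x) m) \<in> measurable M (count_space UNIV)"
proof -
  have map [measurable]: "(\<lambda>x. map (y' x) [0..<k]) \<in> measurable M (count_space UNIV)"
    if [measurable]: "\<And>k. (\<lambda>x. y' x k) \<in> measurable M (count_space UNIV)" for k
    and y' :: "'a \<Rightarrow> nat \<Rightarrow> nat"
    by (induction k) simp_all
  have code [measurable]: "(\<lambda>x. prefix_code (y x) m) \<in> measurable M (count_space UNIV)" for m
    unfolding prefix_code_def by (rule measurable_compose[OF map]) simp_all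
  have tl [measurable]: "(\<lambda>x. tail (y x) k) \<in> measurable M (count_space UNIV)" for k
    unfolding tail_def by measurable
  have coord [measurable]: "(\<lambda>x. coord (tail (y x)) i m) \<in> measurable M (count_space UNIV)" for i m
    unfolding coord_def by measurable
  have ar [measurable]: "(\<lambda>x. arity (tail (y x))) \<in> measurable M (count_space UNIV)"
    unfolding arity_def by measurable
  have [measurable]: "Measurable.pred M (\<lambda>x. m \<in> trail (tail (y x)))" for m
  proof -
    have [measurable]: "(\<lambda>x. list_encode (map (tail (y x)) [0..<k])) \<in> measurable M (count_space UNIV)"
      for k by (rule measurable_compose[OF map]) simp_all
    show ?thesis unfolding trail_def image_iff bex_UNIV by measurable
  qed
  have "Measurable.pred M (\<lambda>x. m \<in> homog (coord (tail (y x))) (trail (tail (y x))) n)" for m n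
    by (rule pred_homog) measurable
  then have arena [measurable]: "Measurable.pred M (\<lambda>x. m \<in> arena (tail (y x)))" for m
    unfolding arena_def
    by (rule measurable_compose_countable[of
          "\<lambda>n x. m \<in> homog (coord (tail (y x))) (trail (tail (y x))) n", OF _ ar])
  have least: "(\<lambda>x. LEAST m. m \<in> arena (tail (y x))) \<in> measurable M (count_space UNIV)"
    by measurable
  have [measurable]: "(\<lambda>x. tail (y x) (LEAST m. m \<in> arena (tail (y x)))) \<in> measurable M (count_space UNIV)"
    using measurable_compose_countable[of "\<lambda>m x. tail (y x) m", OF tl least] .
  have off [measurable]: "(\<lambda>x. offset (tail (y x))) \<in> measurable M (count_space UNIV)"
    unfolding offset_def by measurable
  have slot [measurable]: "(\<lambda>x. slot (y x)) \<in> measurable M (count_space UNIV)"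
    unfolding slot_def by measurable
  have "Measurable.pred M (\<lambda>x. wild (coord (tail (y x))) (arena (tail (y x))) i)" for i
    by (rule pred_wild) measurable
  then have [measurable]:
    "Measurable.pred M (\<lambda>x. wild (coord (tail (y x))) (arena (tail (y x))) (slot (y x)))"
    by (rule measurable_compose_countable[of
          "\<lambda>i x. wild (coord (tail (y x))) (arena (tail (y x))) i", OF _ slot])
  have [measurable]: "Measurable.pred M (\<lambda>x. offset (tail (y x)) \<le> y x 0)"
    using off y by (rule pred_countable_rel)
  have [measurable]: "Measurable.pred M (\<lambda>x. slot (y x) < arity (tail (y x)))"
    using slot ar by (rule pred_countable_rel)
  have [measurable]: "Measurable.pred M (\<lambda>x. swapped (y x) m)"
    unfolding swapped_def by measurable
  have [measurable]: "(\<lambda>x. coord (tail (y x)) (slot (y x)) m) \<in> measurable M (count_space UNIV)"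
    using measurable_compose_countable[of "\<lambda>i x. coord (tail (y x)) i m", OF coord slot] .
  show ?thesis unfolding member_def by measurable
qed

text \<open>
  The prefix code at place \<open>2 * k + 1\<close> is long enough to contain the entry \<open>k\<close>, and no arena contains an
  odd number.
\<close>

definition recover :: "(nat \<Rightarrow> nat) \<Rightarrow> nat \<Rightarrow> nat" where
  "recover x k = list_decode (x (2 * k + 1)) ! k"

lemma recover_member: "recover (member y) = y"
proof
  fix k
  have "\<not> swapped y (2 * k + 1)"
    using arena_subset_trail even_trail by (fastforce simp: swapped_def)
  then show "recover (member y) k = y k"
    by (simp add: recover_def member_def nth_list_decode_prefix_code)
qed

text \<open>
  By \<open>recover_member\<close>, a real \<open>x\<close> belongs to the family iff it is the member indexed by
  \<open>recover x\<close>. This is a countable conjunction of Borel conditions.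
\<close>

lemma range_member_borel: "range member \<in> sets borel"
proof -
  have cs: "measurable (borel :: (nat \<Rightarrow> nat) measure) (borel :: nat measure) = measurable borel (count_space UNIV)"
    by (rule measurable_cong_sets) (simp_all add: sets_borel_eq_count_space)
  have [measurable]: "(\<lambda>x :: nat \<Rightarrow> nat. x k) \<in> measurable borel (count_space UNIV)" for k
    unfolding cs[symmetric] by (rule measurable_product_coordinates)
  have [measurable]: "(\<lambda>x. recover x k) \<in> measurable borel (count_space UNIV)" for k
    unfolding recover_def by measurable
  have [measurable]: "(\<lambda>x. member (recover x) m) \<in> measurable borel (count_space UNIV)" for m
    by (rule measurable_member) measurable
  have "Measurable.pred borel (\<lambda>x. \<forall>m. member (recover x) m = x m)" by measurable
  moreover have "range member = {x. \<forall>m. member (recover x) m = x m}"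
    by (auto simp: recover_member fun_eq_iff[symmetric] intro: range_eqI[OF sym])
  ultimately show ?thesis by (simp add: pred_def)
qed

section \<open>Maximality of the powers\<close>

lemma fun_product_UNIV: "fun_product UNIV fs = (\<lambda>a. map (\<lambda>f. f a) fs)"
  by (simp add: fun_product_def fun_eq_iff)

text \<open>
  A function that extends the power to a larger eventually different family would be met infinitely
  often by a product that catches it, and hence would coincide with that product.
\<close>

lemma med_family_power:
  assumes ed: "pairwise (eventually_different UNIV) F"
    and catch: "\<And>g. (\<And>m. length (g m) = n) \<Longrightarrow>
      \<exists>fs. length fs = n \<and> set fs \<subseteq> F \<and> infinite {m. map (\<lambda>f. f m) fs = g m}"
  shows "med_family UNIV (set_power UNIV n) (family_power UNIV F n)"
  unfolding med_family_def
proof (intro conjI allI impI)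
  have "eventually_different UNIV u v"
    if u_in: "u \<in> family_power UNIV F n" and v_in: "v \<in> family_power UNIV F n"
      and "u \<noteq> v" for u v
  proof -
    obtain fs gs where u: "u = (\<lambda>a. map (\<lambda>f. f a) fs)" "set fs \<subseteq> F" "length fs = n"
      and v: "v = (\<lambda>a. map (\<lambda>f. f a) gs)" "set gs \<subseteq> F" "length gs = n"
      using u_in v_in unfolding family_power_def fun_product_UNIV by blast
    have "fs \<noteq> gs" using u v \<open>u \<noteq> v\<close> by auto
    then obtain i where i: "i < n" "fs ! i \<noteq> gs ! i"
      using u(3) v(3) nth_equalityI[of fs gs] by auto
    then have "finite {a. (fs ! i) a = (gs ! i) a}"
      using ed u v nth_mem unfolding pairwise_def eventually_different_def agreement_def
      by (simp add: subset_iff)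
    moreover have "{a. u a = v a} \<subseteq> {a. (fs ! i) a = (gs ! i) a}"
      using u v i by (auto dest!: arg_cong[where f = "\<lambda>xs. xs ! i"])
    ultimately show ?thesis
      by (simp add: eventually_different_def agreement_def finite_subset)
  qed
  then show "ed_family UNIV (set_power UNIV n) (family_power UNIV F n)"
    by (auto simp: ed_family_def pairwise_def family_power_def fun_product_UNIV set_power_def)
next
  fix G assume G: "ed_family UNIV (set_power UNIV n) G \<and> family_power UNIV F n \<subseteq> G"
  show "G = family_power UNIV F n"
  proof (rule antisym)
    show "G \<subseteq> family_power UNIV F n"
    proof
      fix g assume "g \<in> G"
      then have "length (g m) = n" for m
        using G by (auto simp: ed_family_def set_power_def)
      then obtain fs where fs: "length fs = n" "set fs \<subseteq> F"
        "infinite {m. map (\<lambda>f. f m) fs = g m}" using catch by blast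
      have "fun_product UNIV fs \<in> family_power UNIV F n"
        using fs by (auto simp: family_power_def)
      moreover have "fun_product UNIV fs = g"
      proof (rule ccontr)
        assume "fun_product UNIV fs \<noteq> g"
        then have "eventually_different UNIV (fun_product UNIV fs) g"
          using G \<open>g \<in> G\<close> calculation by (auto simp: ed_family_def pairwise_def)
        then show False
          using fs(3) by (simp add: eventually_different_def agreement_def fun_product_UNIV)
      qed
      ultimately show "g \<in> family_power UNIV F n" by simp
    qed
  qed (use G in blast)
qed

lemma med_family_from_catching:
  assumes ed: "pairwise (eventually_different UNIV) F"
    and catch: "\<And>g. \<exists>f\<in>F. infinite {m. f m = g m}"
  shows "med_family UNIV UNIV F"
  unfolding med_family_def
proof (intro conjI allI impI)
  show "ed_family UNIV UNIV F" using ed by (simp add: ed_family_def)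
  fix G assume G: "ed_family UNIV UNIV G \<and> F \<subseteq> G"
  have "g \<in> F" if "g \<in> G" for g
  proof -
    obtain f where f: "f \<in> F" "infinite {m. f m = g m}" using catch by blast
    then have "\<not> eventually_different UNIV f g"
      by (simp add: eventually_different_def agreement_def)
    then have "f = g" using G f(1) that by (auto simp: ed_family_def pairwise_def)
    then show ?thesis using f(1) by simp
  qed
  then show "G = F" using G by blast
qed

theorem theorem4p7:
  "\<exists>F :: (nat \<Rightarrow> nat) set.
     F \<in> sets borel \<and>
     med_family UNIV UNIV F \<and>
     finitely_productive UNIV UNIV F"
proof (intro exI[of _ "range member"] conjI)
  show "range member \<in> sets borel" by (rule range_member_borel)
  have ed: "pairwise (eventually_different UNIV) (range member)"
    by (auto simp: pairwise_def eventually_different_def agreement_def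
        intro!: finite_member_agreement)
  have "\<exists>f\<in>range member. infinite {m. f m = g m}" for g
    using members_catch_tuple[of "\<lambda>m. [g m]" 1] by (auto simp: length_Suc_conv)
  with ed show med: "med_family UNIV UNIV (range member)" by (rule med_family_from_catching)
  show "finitely_productive UNIV UNIV (range member)"
    unfolding finitely_productive_def n_productive_def
    using med med_family_power[OF ed members_catch_tuple] by blast
qed

end
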